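(* Let $\mathbb{C}=(C,\otimes,I)$ be a monoidal category and let $\mathsf{S}=(S,\delta)$ be a cosemigroup object in $\mathbb{C}$. Then $\mathsf{Comult}_{\mathbb{C}}(\mathsf{S}):=(\mathit{Comult}_{\mathbb{C}}(\mathsf{S}),\star,(id_S,id_S))$ is a monoid under $(L',R')\star(L,R):=(L\circ L',R'\circ R)$. In fact $\mathit{Comult}_{\mathbb{C}}(\mathsf{S})$ is a submonoid of the product monoid $\mathbf{Coact}_{\mathsf{S}}(\mathbb{C})((S,\delta),(S,\delta))^{op}\times {}_{\mathsf{S}}\mathbf{Coact}(\mathbb{C})((S,\delta),(S,\delta))$.
   Context: A cosemigroup object in $\mathbb{C}$ is a pair $(S,\delta\colon S\to S\otimes S)$ with $\delta$ coassociative (no counit required). $\mathbf{Coact}_{\mathsf{S}}(\mathbb{C})((S,\delta),(S,\delta))$ is the monoid, under composition in $C$, of $C$-morphisms $L\colon S\to S$ with $\delta\circ L=(L\otimes id_S)\circ\delta$ (endomorphisms of $S$ as a right $\mathsf{S}$-coact), and ${}_{\mathsf{S}}\mathbf{Coact}(\mathbb{C})((S,\delta),(S,\delta))$ is the monoid, under composition in $C$, of $C$-morphisms $R\colon S\to S$ with $\delta\circ R=(id_S\otimes R)\circ\delta$ (endomorphisms of $S$ as a left $\mathsf{S}$-coact). $(-)^{op}$ denotes the opposite monoid. $\mathit{Comult}_{\mathbb{C}}(\mathsf{S})$ is the set of pairs $(L,R)\in\mathbf{Coact}_{\mathsf{S}}(\mathbb{C})((S,\delta),(S,\delta))\times{}_{\mathsf{S}}\mathbf{Coact}(\mathbb{C})((S,\delta),(S,\delta))$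 with $(id_S\otimes L)\circ\delta=(R\otimes id_S)\circ\delta$. *)

theory Defs
  imports "HOL-Algebra.Group"
begin

section \<open>Monoidal categories\<close>

record ('o, 'm) category =
  Obj :: "'o set"
  Arr :: "'m set"
  Dom :: "'m \<Rightarrow> 'o"
  Cod :: "'m \<Rightarrow> 'o"
  Ide :: "'o \<Rightarrow> 'm"
  Comp :: "'m \<Rightarrow> 'm \<Rightarrow> 'm" (infixr \<open>\<cdot>\<index>\<close> 65)

definition hom_set :: "('o, 'm, 'z) category_scheme \<Rightarrow> 'o \<Rightarrow> 'o \<Rightarrow> 'm set"
  where "hom_set C A B = {f \<in> Arr C. Dom C f = A \<and> Cod C f = B}"

locale category =
  fixes C :: "('o, 'm, 'z) category_scheme" (structure)
  assumes Dom_closed: "f \<in> Arr C \<Longrightarrow> Dom C f \<in> Obj C"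
    and Cod_closed: "f \<in> Arr C \<Longrightarrow> Cod C f \<in> Obj C"
    and Ide_hom: "A \<in> Obj C \<Longrightarrow> Ide C A \<in> hom_set C A A"
    and Comp_hom: "\<lbrakk>f \<in> hom_set C A B; g \<in> hom_set C B D\<rbrakk> \<Longrightarrow> g \<cdot> f \<in> hom_set C A D"
    and Comp_assoc:
      "\<lbrakk>f \<in> hom_set C A B; g \<in> hom_set C B D; h \<in> hom_set C D E\<rbrakk>
        \<Longrightarrow> (h \<cdot> g) \<cdot> f = h \<cdot> (g \<cdot> f)"
    and Comp_Ide_left: "f \<in> hom_set C A B \<Longrightarrow> Ide C B \<cdot> f = f"
    and Comp_Ide_right: "f \<in> hom_set C A B \<Longrightarrow> f \<cdot> Ide C A = f"

definition iso_set :: "('o, 'm, 'z) category_scheme \<Rightarrow> 'o \<Rightarrow> 'o \<Rightarrow> 'm set"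
  where "iso_set C A B =
    {f \<in> hom_set C A B.
      \<exists>g \<in> hom_set C B A. g \<cdot>\<^bsub>C\<^esub> f = Ide C A \<and> f \<cdot>\<^bsub>C\<^esub> g = Ide C B}"

record ('o, 'm) monoidal_category = "('o, 'm) category" +
  TensorObj :: "'o \<Rightarrow> 'o \<Rightarrow> 'o" (infixr \<open>\<otimes>\<^sub>o\<index>\<close> 70)
  TensorArr :: "'m \<Rightarrow> 'm \<Rightarrow> 'm" (infixr \<open>\<otimes>\<^sub>a\<index>\<close> 70)
  UnitObj :: 'o
  Associator :: "'o \<Rightarrow> 'o \<Rightarrow> 'o \<Rightarrow> 'm"
  LeftUnitor :: "'o \<Rightarrow> 'm"
  RightUnitor :: "'o \<Rightarrow> 'm"

locale monoidal_category = category C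
  for C :: "('o, 'm, 'z) monoidal_category_scheme" (structure) +
  assumes TensorObj_closed: "\<lbrakk>A \<in> Obj C; B \<in> Obj C\<rbrakk> \<Longrightarrow> A \<otimes>\<^sub>o B \<in> Obj C"
    and TensorArr_hom:
      "\<lbrakk>f \<in> hom_set C A A'; g \<in> hom_set C B B'\<rbrakk>
        \<Longrightarrow> f \<otimes>\<^sub>a g \<in> hom_set C (A \<otimes>\<^sub>o B) (A' \<otimes>\<^sub>o B')"
    and TensorArr_Ide:
      "\<lbrakk>A \<in> Obj C; B \<in> Obj C\<rbrakk> \<Longrightarrow> Ide C A \<otimes>\<^sub>a Ide C B = Ide C (A \<otimes>\<^sub>o B)"
    and TensorArr_Comp:
      "\<lbrakk>f \<in> hom_set C A A'; f' \<in> hom_set C A' A'';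
        g \<in> hom_set C B B'; g' \<in> hom_set C B' B''\<rbrakk>
        \<Longrightarrow> (f' \<cdot> f) \<otimes>\<^sub>a (g' \<cdot> g) = (f' \<otimes>\<^sub>a g') \<cdot> (f \<otimes>\<^sub>a g)"
    and UnitObj_closed: "UnitObj C \<in> Obj C"
    and Associator_iso:
      "\<lbrakk>A \<in> Obj C; B \<in> Obj C; D \<in> Obj C\<rbrakk>
        \<Longrightarrow> Associator C A B D \<in> iso_set C ((A \<otimes>\<^sub>o B) \<otimes>\<^sub>o D) (A \<otimes>\<^sub>o (B \<otimes>\<^sub>o D))"
    and Associator_natural:
      "\<lbrakk>f \<in> hom_set C A A'; g \<in> hom_set C B B'; h \<in> hom_set C D D'\<rbrakk>
        \<Longrightarrow> Associator C A' B' D' \<cdot> ((f \<otimes>\<^sub>a g) \<otimes>\<^sub>a h)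
          = (f \<otimes>\<^sub>a (g \<otimes>\<^sub>a h)) \<cdot> Associator C A B D"
    and LeftUnitor_iso: "A \<in> Obj C \<Longrightarrow> LeftUnitor C A \<in> iso_set C (UnitObj C \<otimes>\<^sub>o A) A"
    and LeftUnitor_natural:
      "f \<in> hom_set C A B
        \<Longrightarrow> LeftUnitor C B \<cdot> (Ide C (UnitObj C) \<otimes>\<^sub>a f) = f \<cdot> LeftUnitor C A"
    and RightUnitor_iso: "A \<in> Obj C \<Longrightarrow> RightUnitor C A \<in> iso_set C (A \<otimes>\<^sub>o UnitObj C) A"
    and RightUnitor_natural:
      "f \<in> hom_set C A B
        \<Longrightarrow> RightUnitor C B \<cdot> (f \<otimes>\<^sub>a Ide C (UnitObj C)) = f \<cdot> RightUnitor C A"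
    and pentagon:
      "\<lbrakk>A \<in> Obj C; B \<in> Obj C; D \<in> Obj C; E \<in> Obj C\<rbrakk>
        \<Longrightarrow> Associator C A B (D \<otimes>\<^sub>o E) \<cdot> Associator C (A \<otimes>\<^sub>o B) D E
          = (Ide C A \<otimes>\<^sub>a Associator C B D E) \<cdot> Associator C A (B \<otimes>\<^sub>o D) E
              \<cdot> (Associator C A B D \<otimes>\<^sub>a Ide C E)"
    and triangle:
      "\<lbrakk>A \<in> Obj C; B \<in> Obj C\<rbrakk>
        \<Longrightarrow> (Ide C A \<otimes>\<^sub>a LeftUnitor C B) \<cdot> Associator C A (UnitObj C) B
          = RightUnitor C A \<otimes>\<^sub>a Ide C B"


section \<open>Cosemigroup objects and their coact endomorphisms\<close>

locale cosemigroup_object = monoidal_category C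
  for C :: "('o, 'm, 'z) monoidal_category_scheme" (structure) +
  fixes S :: 'o and \<delta> :: 'm
  assumes S_obj: "S \<in> Obj C"
    and delta_hom: "\<delta> \<in> hom_set C S (S \<otimes>\<^sub>o S)"
    and coassoc:
      "Associator C S S S \<cdot> (\<delta> \<otimes>\<^sub>a Ide C S) \<cdot> \<delta> = (Ide C S \<otimes>\<^sub>a \<delta>) \<cdot> \<delta>"

definition right_coact_end ::
    "('o, 'm, 'z) monoidal_category_scheme \<Rightarrow> 'o \<Rightarrow> 'm \<Rightarrow> 'm monoid"
  where "right_coact_end C S \<delta> =
    \<lparr>carrier = {L \<in> hom_set C S S. \<delta> \<cdot>\<^bsub>C\<^esub> L = (L \<otimes>\<^sub>a\<^bsub>C\<^esub> Ide C S) \<cdot>\<^bsub>C\<^esub> \<delta>},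
     mult = Comp C,
     one = Ide C S\<rparr>"

definition left_coact_end ::
    "('o, 'm, 'z) monoidal_category_scheme \<Rightarrow> 'o \<Rightarrow> 'm \<Rightarrow> 'm monoid"
  where "left_coact_end C S \<delta> =
    \<lparr>carrier = {R \<in> hom_set C S S. \<delta> \<cdot>\<^bsub>C\<^esub> R = (Ide C S \<otimes>\<^sub>a\<^bsub>C\<^esub> R) \<cdot>\<^bsub>C\<^esub> \<delta>},
     mult = Comp C,
     one = Ide C S\<rparr>"

definition opposite_monoid :: "('a, 'z) monoid_scheme \<Rightarrow> 'a monoid"
  where "opposite_monoid G =
    \<lparr>carrier = carrier G, mult = (\<lambda>x y. y \<otimes>\<^bsub>G\<^esub> x), one = \<one>\<^bsub>G\<^esub>\<rparr>"

definition Comult ::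
    "('o, 'm, 'z) monoidal_category_scheme \<Rightarrow> 'o \<Rightarrow> 'm \<Rightarrow> ('m \<times> 'm) set"
  where "Comult C S \<delta> =
    {(L, R). L \<in> carrier (right_coact_end C S \<delta>) \<and> R \<in> carrier (left_coact_end C S \<delta>)
      \<and> (Ide C S \<otimes>\<^sub>a\<^bsub>C\<^esub> L) \<cdot>\<^bsub>C\<^esub> \<delta> = (R \<otimes>\<^sub>a\<^bsub>C\<^esub> Ide C S) \<cdot>\<^bsub>C\<^esub> \<delta>}"

definition Comult_monoid ::
    "('o, 'm, 'z) monoidal_category_scheme \<Rightarrow> 'o \<Rightarrow> 'm \<Rightarrow> ('m \<times> 'm) monoid"
  where "Comult_monoid C S \<delta> =
    \<lparr>carrier = Comult C S \<delta>,
     mult = (\<lambda>(L', R') (L, R). (L \<cdot>\<^bsub>C\<^esub> L', R' \<cdot>\<^bsub>C\<^esub> R)),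
     one = (Ide C S, Ide C S)\<rparr>"

end

theory Submission
  imports Defs
begin

text \<open>The heart is closure of \<open>Comult C S \<delta>\<close> under the product. Morphisms
  acting on different tensor factors commute, so two linked pairs give (id \<otimes> L L') \<delta>
  = (id \<otimes> L)(R' \<otimes> id) \<delta> = (R' \<otimes> id)(id \<otimes> L) \<delta> = (R' R
  \<otimes> id) \<delta>. The exchange reverses the order of the first components relative to the
  second, which is why the opposite monoid appears (\<open>Comult_Comp\<close>). The coact
  conditions are preserved by composition, by sliding \<delta> past one factor at a time
  (\<open>right_coact_end_Comp\<close>, \<open>left_coact_end_Comp\<close>). The monoid laws are
  then inherited from the product monoid, whose multiplication is the prescribed one.\<close>

context monoidal_category
begin

lemma whisker_right_Comp:
  assumes f: "f \<in> hom_set C A A'" and f': "f' \<in> hom_set C A' A''" and B: "B \<in> Obj C"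
  shows "(f' \<cdot> f) \<otimes>\<^sub>a Ide C B = (f' \<otimes>\<^sub>a Ide C B) \<cdot> (f \<otimes>\<^sub>a Ide C B)"
  using TensorArr_Comp[OF f f' Ide_hom[OF B] Ide_hom[OF B]] Comp_Ide_left[OF Ide_hom[OF B]]
  by simp

lemma whisker_left_Comp:
  assumes g: "g \<in> hom_set C B B'" and g': "g' \<in> hom_set C B' B''" and A: "A \<in> Obj C"
  shows "Ide C A \<otimes>\<^sub>a (g' \<cdot> g) = (Ide C A \<otimes>\<^sub>a g') \<cdot> (Ide C A \<otimes>\<^sub>a g)"
  using TensorArr_Comp[OF Ide_hom[OF A] Ide_hom[OF A] g g'] Comp_Ide_left[OF Ide_hom[OF A]]
  by simp

text \<open>By bifunctoriality and the unit laws, both composites equal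
  \<open>f \<otimes>\<^sub>a g\<close>.\<close>

lemma interchange:
  assumes f: "f \<in> hom_set C A A'" and g: "g \<in> hom_set C B B'"
    and obj: "A \<in> Obj C" "A' \<in> Obj C" "B \<in> Obj C" "B' \<in> Obj C"
  shows "(Ide C A' \<otimes>\<^sub>a g) \<cdot> (f \<otimes>\<^sub>a Ide C B) = (f \<otimes>\<^sub>a Ide C B') \<cdot> (Ide C A \<otimes>\<^sub>a g)"
  using TensorArr_Comp[OF f Ide_hom[OF obj(2)] Ide_hom[OF obj(3)] g]
    TensorArr_Comp[OF Ide_hom[OF obj(1)] f g Ide_hom[OF obj(4)]]
  by (simp add: Comp_Ide_left[OF f] Comp_Ide_left[OF g] Comp_Ide_right[OF f] Comp_Ide_right[OF g])

end

context cosemigroup_object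
begin

lemmas S_rules = S_obj delta_hom Ide_hom[OF S_obj] TensorObj_closed[OF S_obj S_obj]

lemma whisker_hom:
  assumes "f \<in> hom_set C S S"
  shows "f \<otimes>\<^sub>a Ide C S \<in> hom_set C (S \<otimes>\<^sub>o S) (S \<otimes>\<^sub>o S)"
    and "Ide C S \<otimes>\<^sub>a f \<in> hom_set C (S \<otimes>\<^sub>o S) (S \<otimes>\<^sub>o S)"
  using assms by (auto intro: TensorArr_hom S_rules)

lemma Ide_whisker_delta: "(Ide C S \<otimes>\<^sub>a Ide C S) \<cdot> \<delta> = \<delta>"
  by (simp add: TensorArr_Ide S_obj Comp_Ide_left[OF delta_hom])

text \<open>Keeping \<delta> innermost in a right-nested composite lets a defining equation about
  \<delta> be applied directly to the inner factor; the next two lemmas have this form for the same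
  reason.\<close>

lemma whisker_right_Comp_delta:
  assumes f: "f \<in> hom_set C S S" and g: "g \<in> hom_set C S S"
  shows "((g \<cdot> f) \<otimes>\<^sub>a Ide C S) \<cdot> \<delta> = (g \<otimes>\<^sub>a Ide C S) \<cdot> (f \<otimes>\<^sub>a Ide C S) \<cdot> \<delta>"
  by (simp add: whisker_right_Comp[OF f g S_obj]
      Comp_assoc[OF delta_hom whisker_hom(1)[OF f] whisker_hom(1)[OF g]])

lemma whisker_left_Comp_delta:
  assumes f: "f \<in> hom_set C S S" and g: "g \<in> hom_set C S S"
  shows "(Ide C S \<otimes>\<^sub>a (g \<cdot> f)) \<cdot> \<delta> = (Ide C S \<otimes>\<^sub>a g) \<cdot> (Ide C S \<otimes>\<^sub>a f) \<cdot> \<delta>"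
  by (simp add: whisker_left_Comp[OF f g S_obj]
      Comp_assoc[OF delta_hom whisker_hom(2)[OF f] whisker_hom(2)[OF g]])

lemma interchange_delta:
  assumes f: "f \<in> hom_set C S S" and g: "g \<in> hom_set C S S"
  shows "(Ide C S \<otimes>\<^sub>a g) \<cdot> (f \<otimes>\<^sub>a Ide C S) \<cdot> \<delta> = (f \<otimes>\<^sub>a Ide C S) \<cdot> (Ide C S \<otimes>\<^sub>a g) \<cdot> \<delta>"
  using Comp_assoc[OF delta_hom whisker_hom(1)[OF f] whisker_hom(2)[OF g]]
    Comp_assoc[OF delta_hom whisker_hom(2)[OF g] whisker_hom(1)[OF f]]
    interchange[OF f g S_obj S_obj S_obj S_obj]
  by simp

text \<open>\<delta> slides past \<open>g\<close>, then past \<open>f\<close>, and functoriality of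
  whiskering merges the two whiskered factors.\<close>

lemma right_coact_end_Comp:
  assumes f: "f \<in> hom_set C S S" "\<delta> \<cdot> f = (f \<otimes>\<^sub>a Ide C S) \<cdot> \<delta>"
    and g: "g \<in> hom_set C S S" "\<delta> \<cdot> g = (g \<otimes>\<^sub>a Ide C S) \<cdot> \<delta>"
  shows "\<delta> \<cdot> g \<cdot> f = ((g \<cdot> f) \<otimes>\<^sub>a Ide C S) \<cdot> \<delta>"
proof -
  have "\<delta> \<cdot> g \<cdot> f = ((g \<otimes>\<^sub>a Ide C S) \<cdot> \<delta>) \<cdot> f"
    using Comp_assoc[OF f(1) g(1) delta_hom] g(2) by simp
  also have "\<dots> = (g \<otimes>\<^sub>a Ide C S) \<cdot> (f \<otimes>\<^sub>a Ide C S) \<cdot> \<delta>"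
    using Comp_assoc[OF f(1) delta_hom whisker_hom(1)[OF g(1)]] f(2) by simp
  finally show ?thesis
    by (simp add: whisker_right_Comp_delta[OF f(1) g(1)])
qed

lemma left_coact_end_Comp:
  assumes f: "f \<in> hom_set C S S" "\<delta> \<cdot> f = (Ide C S \<otimes>\<^sub>a f) \<cdot> \<delta>"
    and g: "g \<in> hom_set C S S" "\<delta> \<cdot> g = (Ide C S \<otimes>\<^sub>a g) \<cdot> \<delta>"
  shows "\<delta> \<cdot> g \<cdot> f = (Ide C S \<otimes>\<^sub>a (g \<cdot> f)) \<cdot> \<delta>"
proof -
  have "\<delta> \<cdot> g \<cdot> f = ((Ide C S \<otimes>\<^sub>a g) \<cdot> \<delta>) \<cdot> f"
    using Comp_assoc[OF f(1) g(1) delta_hom] g(2) by simp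
  also have "\<dots> = (Ide C S \<otimes>\<^sub>a g) \<cdot> (Ide C S \<otimes>\<^sub>a f) \<cdot> \<delta>"
    using Comp_assoc[OF f(1) delta_hom whisker_hom(2)[OF g(1)]] f(2) by simp
  finally show ?thesis
    by (simp add: whisker_left_Comp_delta[OF f(1) g(1)])
qed

text \<open>Associativity and units come from composition in \<open>C\<close>; the identity
  qualifies because whiskering it yields an identity, absorbed by \<delta>.\<close>

lemma monoid_right_coact_end: "monoid (right_coact_end C S \<delta>)"
  by (rule monoidI)
    (auto simp: right_coact_end_def right_coact_end_Comp Ide_whisker_delta
      Comp_Ide_right[OF delta_hom] Comp_Ide_left Comp_Ide_right
      intro: Comp_hom Comp_assoc S_rules)

lemma monoid_left_coact_end: "monoid (left_coact_end C S \<delta>)"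
  by (rule monoidI)
    (auto simp: left_coact_end_def left_coact_end_Comp Ide_whisker_delta
      Comp_Ide_right[OF delta_hom] Comp_Ide_left Comp_Ide_right
      intro: Comp_hom Comp_assoc S_rules)

lemma Comult_Comp:
  assumes hom: "L \<in> hom_set C S S" "R \<in> hom_set C S S" "L' \<in> hom_set C S S" "R' \<in> hom_set C S S"
    and LR: "(Ide C S \<otimes>\<^sub>a L) \<cdot> \<delta> = (R \<otimes>\<^sub>a Ide C S) \<cdot> \<delta>"
    and LR': "(Ide C S \<otimes>\<^sub>a L') \<cdot> \<delta> = (R' \<otimes>\<^sub>a Ide C S) \<cdot> \<delta>"
  shows "(Ide C S \<otimes>\<^sub>a (L \<cdot> L')) \<cdot> \<delta> = ((R' \<cdot> R) \<otimes>\<^sub>a Ide C S) \<cdot> \<delta>"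
proof -
  have "(Ide C S \<otimes>\<^sub>a (L \<cdot> L')) \<cdot> \<delta> = (Ide C S \<otimes>\<^sub>a L) \<cdot> (R' \<otimes>\<^sub>a Ide C S) \<cdot> \<delta>"
    by (simp add: whisker_left_Comp_delta hom LR')
  \<comment> \<open>Interchange brings \<open>L\<close> next to \<delta>, where the link between
    \<open>L\<close> and \<open>R\<close> applies.\<close>
  also have "\<dots> = (R' \<otimes>\<^sub>a Ide C S) \<cdot> (R \<otimes>\<^sub>a Ide C S) \<cdot> \<delta>"
    by (simp add: interchange_delta hom LR)
  finally show ?thesis
    by (simp add: whisker_right_Comp_delta hom)
qed

end

lemma monoid_opposite_monoid:
  assumes "monoid G"
  shows "monoid (opposite_monoid G)"
proof -
  interpret monoid G by fact
  show ?thesis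
    by (rule monoidI) (auto simp: opposite_monoid_def m_assoc)
qed

lemma (in cosemigroup_object) submonoid_Comult:
  "submonoid (Comult C S \<delta>)
    (opposite_monoid (right_coact_end C S \<delta>) \<times>\<times> left_coact_end C S \<delta>)"
proof -
  \<comment> \<open>The prefixes refer to the side of the coaction: the first components L of pairs
    live in the monoid \<open>R\<close>, the second components R in \<open>L\<close>.\<close>
  interpret R: monoid "right_coact_end C S \<delta>" by (rule monoid_right_coact_end)
  interpret L: monoid "left_coact_end C S \<delta>" by (rule monoid_left_coact_end)
  \<comment> \<open>Only operations and units are exposed; carriers stay folded, so the coact
    conditions come from the closure laws of the two monoids and only the linking equation remains.
    For the unit pair both its sides coincide.\<close>
  have mult: "mult (right_coact_end C S \<delta>) = Comp C" "mult (left_coact_end C S \<delta>) = Comp C"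
    and one: "one (right_coact_end C S \<delta>) = Ide C S" "one (left_coact_end C S \<delta>) = Ide C S"
    and hom: "f \<in> carrier (right_coact_end C S \<delta>) \<Longrightarrow> f \<in> hom_set C S S"
      "f \<in> carrier (left_coact_end C S \<delta>) \<Longrightarrow> f \<in> hom_set C S S" for f
    by (simp_all add: right_coact_end_def left_coact_end_def)
  show ?thesis
    using R.m_closed L.m_closed R.one_closed L.one_closed
    by unfold_locales
      (auto simp: Comult_def opposite_monoid_def mult one Comult_Comp hom)
qed

theorem proposition28:
  fixes C :: "('o, 'm) monoidal_category" and S :: 'o and \<delta> :: 'm
  assumes "monoidal_category C" and "cosemigroup_object C S \<delta>"
  shows "monoid (Comult_monoid C S \<delta>)
    \<and> monoid (opposite_monoid (right_coact_end C S \<delta>) \<times>\<times> left_coact_end C S \<delta>)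
    \<and> submonoid (Comult C S \<delta>)
        (opposite_monoid (right_coact_end C S \<delta>) \<times>\<times> left_coact_end C S \<delta>)
    \<and> Comult_monoid C S \<delta> =
        (opposite_monoid (right_coact_end C S \<delta>) \<times>\<times> left_coact_end C S \<delta>)
          \<lparr>carrier := Comult C S \<delta>\<rparr>"
proof -
  interpret cosemigroup_object C S \<delta> by fact
  let ?P = "opposite_monoid (right_coact_end C S \<delta>) \<times>\<times> left_coact_end C S \<delta>"
  have mon: "monoid ?P"
    by (intro DirProd_monoid monoid_opposite_monoid monoid_right_coact_end monoid_left_coact_end)
  \<comment> \<open>The opposite in the first factor turns the componentwise product into the
    prescribed one, so the submonoid with its induced structure is literally this record.\<close>
  have eq: "Comult_monoid C S \<delta> = ?P\<lparr>carrier := Comult C S \<delta>\<rparr>"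
    by (simp add: Comult_monoid_def DirProd_def opposite_monoid_def
        right_coact_end_def left_coact_end_def)
  show ?thesis
    using mon submonoid_Comult submonoid.submonoid_is_monoid[OF submonoid_Comult mon]
    by (simp add: eq)
qed

end
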